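(* Let $\psi$ be an $\textit{LTL}_f$ formula and $\phi=G\psi$ (i.e. $\phi=\mathsf{ff}\,R\,\psi$). Then $\phi$ is satisfiable as an $\textit{LTL}_f$ formula iff the propositional formula $\mathit{ofg}(\psi)$ is satisfiable (i.e. there is $A\in\Sigma$ with $A\models\mathit{ofg}(\psi)$).
   Context: Fix a finite set $\mathcal{P}$ of atomic propositions; $L=\mathcal{P}\cup\{\neg a: a\in\mathcal{P}\}$ is the set of literals and $\Sigma=2^{L}$. $\textit{LTL}_f$ formulas are in negation normal form: $\phi::=\mathsf{tt}\mid\mathsf{ff}\mid \ell\mid \phi\wedge\phi\mid\phi\vee\phi\mid X\phi\mid X_w\phi\mid \phi U\phi\mid\phi R\phi$, $\ell\in L$; $G\psi$ abbreviates $\mathsf{ff}\,R\,\psi$. Semantics on finite traces $\eta=\omega_0\ldots\omega_n\in\Sigma^*$ ($n\ge0$, $|\eta|=n+1$, $\eta_i=\omega_i\ldots\omega_n$): $\eta\models\mathsf{tt}$, $\eta\not\models\mathsf{ff}$; $\eta\models\ell$ iff $\ell\in\omega_0$; $\wedge,\vee$ as usual; $\eta\models X\psi$ iff $|\eta|>1$ and $\eta_1\models\psi$; $\eta\models X_w\psi$ iff $|\eta|=1$ or ($|\eta|>1$ and $\eta_1\models\psi$); $\eta\models\phi_1U\phi_2$ iff some $0\le i<|\eta|$ has $\eta_i\models\phi_2$ and $\eta_j\models\phi_1$ for all $j<i$; $\eta\models\phi_1R\phi_2$ iff either $\eta_i\models\phi_2$ for all $0\le i<|\eta|$, or some $0\le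 i<|\eta|$ has $\eta_i\models\phi_1$ and $\eta_j\models\phi_2$ for all $j\le i$. $\phi$ is satisfiable iff some finite trace satisfies it. A letter $A\in\Sigma$ is identified with the length-one trace, so $A\models\alpha$ is defined for propositional $\alpha$. Obligation formulas $\mathit{off},\mathit{ofr},\mathit{ofg}$ (propositional formulas), defined by induction; for $\mathit{ofx}$ ranging over all three: $\mathit{ofx}(\mathsf{tt})=\mathsf{tt}$, $\mathit{ofx}(\mathsf{ff})=\mathsf{ff}$, $\mathit{ofx}(\ell)=\ell$ for literals; $\mathit{ofx}(\phi_1\wedge\phi_2)=\mathit{ofx}(\phi_1)\wedge\mathit{ofx}(\phi_2)$; $\mathit{ofx}(\phi_1\vee\phi_2)=\mathit{ofx}(\phi_1)\vee\mathit{ofx}(\phi_2)$; $\mathit{ofx}(\phi_1U\phi_2)=\mathit{ofx}(\phi_2)$. For Next: $\mathit{off}(X\phi_2)=\mathit{off}(\phi_2)$, $\mathit{ofr}(X\phi_2)=\mathsf{ff}$, $\mathit{ofg}(X\phi_2)=\mathsf{ff}$; $\mathit{off}(X_w\phi_2)=\mathit{off}(\phi_2)$, $\mathit{ofr}(X_w\phi_2)=\mathsf{ff}$, $\mathit{ofg}(X_w\phi_2)=\mathsf{tt}$. For Release: $\mathit{off}(\phi_1R\phi_2)=\mathit{ofr}(\phi_2)$, $\mathit{ofr}(\phi_1R\phi_2)=\mathit{ofr}(\phi_2)$, $\mathit{ofg}(\phi_1R\phi_2)=\mathit{ofg}(\phi_2)$. *)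

theory Defs
  imports Main
begin

datatype (literal_atoms: 'a) literal = Pos 'a | Neg 'a

definition literals :: "'a set \<Rightarrow> 'a literal set" where
  "literals P = Pos ` P \<union> Neg ` P"

datatype (ltlf_atoms: 'a) ltlf =
    TT
  | FF
  | Lit "'a literal"
  | And "'a ltlf" "'a ltlf"
  | Or "'a ltlf" "'a ltlf"
  | Next "'a ltlf"
  | WNext "'a ltlf"
  | Until "'a ltlf" "'a ltlf"
  | Release "'a ltlf" "'a ltlf"

abbreviation Globally :: "'a ltlf \<Rightarrow> 'a ltlf" where
  "Globally \<psi> \<equiv> Release FF \<psi>"

definition ltlf_formulas :: "'a set \<Rightarrow> 'a ltlf set" where
  "ltlf_formulas P = {\<phi>. ltlf_atoms \<phi> \<subseteq> P}"

text \<open>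
  A letter is an arbitrary set of literals; it may contain both \<open>Pos a\<close> and \<open>Neg a\<close>, or neither.
  Traces are nonempty.
\<close>

definition letters :: "'a set \<Rightarrow> 'a literal set set" where
  "letters P = Pow (literals P)"

definition traces :: "'a set \<Rightarrow> 'a literal set list set" where
  "traces P = {\<eta>. \<eta> \<noteq> [] \<and> set \<eta> \<subseteq> letters P}"

text \<open>The suffix of \<open>\<eta>\<close> starting at position \<open>i\<close> is \<open>drop i \<eta>\<close>.  Only nonempty \<open>\<eta>\<close> are relevant.\<close>

primrec ltlf_sat :: "'a literal set list \<Rightarrow> 'a ltlf \<Rightarrow> bool" (infix "\<Turnstile>" 50) where
  "\<eta> \<Turnstile> TT \<longleftrightarrow> True"
| "\<eta> \<Turnstile> FF \<longleftrightarrow> False"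
| "\<eta> \<Turnstile> Lit l \<longleftrightarrow> l \<in> hd \<eta>"
| "\<eta> \<Turnstile> And \<phi> \<psi> \<longleftrightarrow> \<eta> \<Turnstile> \<phi> \<and> \<eta> \<Turnstile> \<psi>"
| "\<eta> \<Turnstile> Or \<phi> \<psi> \<longleftrightarrow> \<eta> \<Turnstile> \<phi> \<or> \<eta> \<Turnstile> \<psi>"
| "\<eta> \<Turnstile> Next \<psi> \<longleftrightarrow> length \<eta> > 1 \<and> drop 1 \<eta> \<Turnstile> \<psi>"
| "\<eta> \<Turnstile> WNext \<psi> \<longleftrightarrow> length \<eta> = 1 \<or> (length \<eta> > 1 \<and> drop 1 \<eta> \<Turnstile> \<psi>)"
| "\<eta> \<Turnstile> Until \<phi> \<psi> \<longleftrightarrow>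
     (\<exists>i<length \<eta>. drop i \<eta> \<Turnstile> \<psi> \<and> (\<forall>j<i. drop j \<eta> \<Turnstile> \<phi>))"
| "\<eta> \<Turnstile> Release \<phi> \<psi> \<longleftrightarrow>
     (\<forall>i<length \<eta>. drop i \<eta> \<Turnstile> \<psi>) \<or>
     (\<exists>i<length \<eta>. drop i \<eta> \<Turnstile> \<phi> \<and> (\<forall>j\<le>i. drop j \<eta> \<Turnstile> \<psi>))"

definition ltlf_satisfiable :: "'a set \<Rightarrow> 'a ltlf \<Rightarrow> bool" where
  "ltlf_satisfiable P \<phi> \<longleftrightarrow> (\<exists>\<eta>\<in>traces P. \<eta> \<Turnstile> \<phi>)"

primrec propositional :: "'a ltlf \<Rightarrow> bool" where
  "propositional TT \<longleftrightarrow> True"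
| "propositional FF \<longleftrightarrow> True"
| "propositional (Lit l) \<longleftrightarrow> True"
| "propositional (And \<phi> \<psi>) \<longleftrightarrow> propositional \<phi> \<and> propositional \<psi>"
| "propositional (Or \<phi> \<psi>) \<longleftrightarrow> propositional \<phi> \<and> propositional \<psi>"
| "propositional (Next \<psi>) \<longleftrightarrow> False"
| "propositional (WNext \<psi>) \<longleftrightarrow> False"
| "propositional (Until \<phi> \<psi>) \<longleftrightarrow> False"
| "propositional (Release \<phi> \<psi>) \<longleftrightarrow> False"

text \<open>
  A letter satisfies a propositional formula if the one-letter trace does.  The definition below is
  meant for propositional formulas only.
\<close>

definition prop_satisfiable :: "'a set \<Rightarrow> 'a ltlf \<Rightarrow> bool" where
  "prop_satisfiable P \<alpha> \<longleftrightarrow> (\<exists>A\<in>letters P. [A] \<Turnstile> \<alpha>)"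

primrec ofg :: "'a ltlf \<Rightarrow> 'a ltlf" where
  "ofg TT = TT"
| "ofg FF = FF"
| "ofg (Lit l) = Lit l"
| "ofg (And \<phi> \<psi>) = And (ofg \<phi>) (ofg \<psi>)"
| "ofg (Or \<phi> \<psi>) = Or (ofg \<phi>) (ofg \<psi>)"
| "ofg (Next \<psi>) = FF"
| "ofg (WNext \<psi>) = TT"
| "ofg (Until \<phi> \<psi>) = ofg \<psi>"
| "ofg (Release \<phi> \<psi>) = ofg \<psi>"

lemma propositional_ofg: "propositional (ofg \<phi>)"
  by (induction \<phi>) simp_all

lemma ltlf_formulas_ofg: "\<phi> \<in> ltlf_formulas P \<Longrightarrow> ofg \<phi> \<in> ltlf_formulas P"
  unfolding ltlf_formulas_def by (induction \<phi>) auto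

end

theory Submission
  imports Defs
begin

text \<open>
  On a trace of length one, a formula and its obligation formula \<open>ofg\<close> are equivalent.  A trace
  satisfying \<open>G \<psi>\<close> satisfies \<open>\<psi>\<close> at its last position, whose suffix has length one; conversely a
  one-letter trace satisfying \<open>\<psi>\<close> satisfies \<open>G \<psi>\<close>.
\<close>

text \<open>With no next position, \<open>Next\<close> fails and \<open>WNext\<close> holds;
  \<open>Until\<close> and \<open>Release\<close> can only use position 0, where both reduce to
  their second argument.\<close>

lemma singleton_sat_ofg: "[A] \<Turnstile> ofg \<phi> \<longleftrightarrow> [A] \<Turnstile> \<phi>"
  by (induction \<phi>) auto

lemma singleton_sat_Globally: "[A] \<Turnstile> Globally \<psi> \<longleftrightarrow> [A] \<Turnstile> \<psi>"
  by simp

lemma sat_Globally_last: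
  assumes "\<eta> \<Turnstile> Globally \<psi>" "\<eta> \<noteq> []"
  shows "[last \<eta>] \<Turnstile> \<psi>"
proof -
  \<comment> \<open>As \<open>FF\<close> holds nowhere, only the first disjunct of
    \<open>Release\<close> remains; \<open>\<eta> \<noteq> []\<close> makes
    \<open>length \<eta> - 1\<close> a valid index.\<close>
  have "drop (length \<eta> - 1) \<eta> \<Turnstile> \<psi>"
    using assms by simp
  moreover have "drop (length \<eta> - 1) \<eta> = [last \<eta>]"
    using assms(2) by (cases \<eta> rule: rev_cases) auto
  ultimately show ?thesis by simp
qed

theorem theorem5:
  fixes P :: "'a set" and \<phi> \<psi> :: "'a ltlf"
  assumes "finite P"
    and "\<psi> \<in> ltlf_formulas P"
    and "\<phi> = Globally \<psi>"
  shows "ltlf_satisfiable P \<phi> \<longleftrightarrow> prop_satisfiable P (ofg \<psi>)"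
proof
  assume "ltlf_satisfiable P \<phi>"
  then obtain \<eta> where "\<eta> \<noteq> []" "set \<eta> \<subseteq> letters P" "\<eta> \<Turnstile> Globally \<psi>"
    unfolding ltlf_satisfiable_def traces_def assms(3) by blast
  \<comment> \<open>The last letter is the witness for \<open>ofg \<psi>\<close>.\<close>
  then have "last \<eta> \<in> letters P" "[last \<eta>] \<Turnstile> ofg \<psi>"
    using last_in_set sat_Globally_last singleton_sat_ofg by blast+
  then show "prop_satisfiable P (ofg \<psi>)"
    unfolding prop_satisfiable_def by blast
next
  assume "prop_satisfiable P (ofg \<psi>)"
  then obtain A where "A \<in> letters P" "[A] \<Turnstile> ofg \<psi>"
    unfolding prop_satisfiable_def by blast
  then have "[A] \<in> traces P" "[A] \<Turnstile> Globally \<psi>"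
    unfolding traces_def singleton_sat_ofg singleton_sat_Globally by simp_all
  then show "ltlf_satisfiable P \<phi>"
    unfolding ltlf_satisfiable_def assms(3) by blast
qed

end
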